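(* There is an absolute constant $C>0$ such that for every instance of the independent action sequential contract problem with $n$ actions and $m$ outcomes, the ratio between the optimal principal's utility over general contracts and the optimal principal's utility over linear contracts is at most $C n^2 m$; that is, $$\sup_{t:[m]\to\mathbb{R}_{\ge0}}u_P(t)\ \le\ C\,n^2 m\cdot\sup_{\alpha\in[0,1]}u_P(t_\alpha).$$
   Context: Sequential contract problem. An instance consists of a set $A$ of $n$ actions with costs $c_i\ge 0$ ($i\in A$), a set $[m]=\{1,\dots,m\}$ of outcomes with principal rewards $0=r(1)\le r(2)\le\dots\le r(m)$, and random variables $X_i$ with values in $[m]$ ($i\in A$), where $X_i$ is the outcome of action $i$. In the independent action model the $X_i$ are independent and $p_{ij}=\Pr[X_i=j]$. A contract is a function $t:[m]\to\mathbb{R}_{\ge 0}$. Given $t$, the agent acts sequentially: at each point he either takes a not-yet-taken action $i$, pays $c_i$ and observes the realization of $X_i$, or halts. On halting he selects one revealed outcome as the final outcome; outcome $1$ (the zero outcome) is always considered revealed. A (deterministic) strategy $\pi$ specifies all these decisions as a function of the history; there are finitely many strategies. $S(\pi)$ is the random set of actions taken, $\omega(\pi)$ the random final outcome. Utilities: $u_A(t,\pi)=\mathbb{E}[t(\omega(\pi))-\sum_{i\in S(\pi)}c_i]$ and $u_P(t,\pi)=\mathbb{E}[r(\omega(\pi))-t(\omega(\pi))]$. The best response $\pi^\star(t)$ is a strategy maximizing $u_A(t,\cdot)$, with ties broken in favour of larger $u_P(t,\cdot)$ and remaining ties broken consistently by a fixed total order on strategies. $u_P(t)=u_P(t,\pi^\star(t))$.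 A linear contract with parameter $\alpha\in[0,1]$ is $t_\alpha(j)=\alpha\cdot r(j)$. *)

theory Defs
  imports "HOL-Probability.Probability"
begin

section \<open>Strategies\<close>

text \<open>
  Actions and outcomes are natural numbers; the outcomes are \<open>{1..m}\<close>. A history lists, in
  chronological order, the actions taken so far together with their observed outcomes.
\<close>

type_synonym history = "(nat \<times> nat) list"

datatype decision = Take nat | Halt nat

type_synonym strategy = "history \<Rightarrow> decision"

definition histories :: "nat set \<Rightarrow> nat \<Rightarrow> history set" where
  "histories A m = {h. distinct (map fst h) \<and> set h \<subseteq> A \<times> {1..m}}"

text \<open>Halting includes the choice of the final outcome among the revealed ones; outcome 1 always
  counts as revealed.\<close>

definition decisions :: "nat set \<Rightarrow> history \<Rightarrow> decision set" where
  "decisions A h = Take ` (A - fst ` set h) \<union> Halt ` insert 1 (snd ` set h)"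

text \<open>Strategies are extensional, so that there are only finitely many of them.\<close>

definition strategies :: "nat set \<Rightarrow> nat \<Rightarrow> strategy set" where
  "strategies A m = (\<Pi>\<^sub>E h\<in>histories A m. decisions A h)"

text \<open>The history after at most \<open>k\<close> steps, when \<open>x i\<close> is the realization of \<open>X\<^sub>i\<close>.\<close>

primrec play :: "strategy \<Rightarrow> (nat \<Rightarrow> nat) \<Rightarrow> nat \<Rightarrow> history" where
  "play \<pi> x 0 = []"
| "play \<pi> x (Suc k) =
     (case \<pi> (play \<pi> x k) of
        Take i \<Rightarrow> play \<pi> x k @ [(i, x i)]
      | Halt j \<Rightarrow> play \<pi> x k)"

text \<open>Every action is taken at most once, so after \<open>card A\<close> steps the strategy has halted; the
  \<open>Take\<close> case in \<open>final_outcome\<close> does not occur for members of \<open>strategies A m\<close>.\<close>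

definition taken :: "nat set \<Rightarrow> strategy \<Rightarrow> (nat \<Rightarrow> nat) \<Rightarrow> nat set" where
  "taken A \<pi> x = fst ` set (play \<pi> x (card A))"

definition final_outcome :: "nat set \<Rightarrow> strategy \<Rightarrow> (nat \<Rightarrow> nat) \<Rightarrow> nat" where
  "final_outcome A \<pi> x = (case \<pi> (play \<pi> x (card A)) of Halt j \<Rightarrow> j | Take i \<Rightarrow> 1)"


section \<open>Instances of the independent action model\<close>

text \<open>\<open>p i\<close> is the distribution of \<open>X\<^sub>i\<close>; \<open>tie\<close> is the fixed total order on strategies
  used to break the remaining ties.\<close>

locale sequential_contract =
  fixes A :: "nat set"
    and c :: "nat \<Rightarrow> real"
    and m :: nat
    and r :: "nat \<Rightarrow> real"
    and p :: "nat \<Rightarrow> nat pmf"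
    and tie :: "(strategy \<times> strategy) set"
  assumes finite_actions: "finite A"
    and cost_nonneg: "\<And>i. i \<in> A \<Longrightarrow> 0 \<le> c i"
    and outcomes_nonempty: "1 \<le> m"
    and reward_first: "r 1 = 0"
    and reward_mono: "mono_on {1..m} r"
    and outcome_range: "\<And>i. i \<in> A \<Longrightarrow> set_pmf (p i) \<subseteq> {1..m}"
    and tie_order: "linear_order_on (strategies A m) tie"
begin

text \<open>Joint law of the independent family \<open>(X\<^sub>i)\<close>, \<open>i \<in> A\<close>; coordinates outside \<open>A\<close>
  get the dummy value 1 and are never inspected.\<close>

definition outcome_law :: "(nat \<Rightarrow> nat) pmf" where
  "outcome_law = Pi_pmf A 1 p"

definition agent_utility :: "(nat \<Rightarrow> real) \<Rightarrow> strategy \<Rightarrow> real" where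
  "agent_utility t \<pi> =
     measure_pmf.expectation outcome_law (\<lambda>x. t (final_outcome A \<pi> x) - (\<Sum>i\<in>taken A \<pi> x. c i))"

definition principal_utility :: "(nat \<Rightarrow> real) \<Rightarrow> strategy \<Rightarrow> real" where
  "principal_utility t \<pi> =
     measure_pmf.expectation outcome_law (\<lambda>x. r (final_outcome A \<pi> x) - t (final_outcome A \<pi> x))"

definition agent_optimal :: "(nat \<Rightarrow> real) \<Rightarrow> strategy set" where
  "agent_optimal t =
     {\<pi> \<in> strategies A m. \<forall>\<pi>'\<in>strategies A m. agent_utility t \<pi>' \<le> agent_utility t \<pi>}"

definition favoured_optimal :: "(nat \<Rightarrow> real) \<Rightarrow> strategy set" where
  "favoured_optimal t =
     {\<pi> \<in> agent_optimal t. \<forall>\<pi>'\<in>agent_optimal t. principal_utility t \<pi>' \<le> principal_utility t \<pi>}"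

definition best_response :: "(nat \<Rightarrow> real) \<Rightarrow> strategy" where
  "best_response t = (THE \<pi>. \<pi> \<in> favoured_optimal t \<and> (\<forall>\<pi>'\<in>favoured_optimal t. (\<pi>, \<pi>') \<in> tie))"

definition principal_value :: "(nat \<Rightarrow> real) \<Rightarrow> real" where
  "principal_value t = principal_utility t (best_response t)"

end

text \<open>Only the values on \<open>{1..m}\<close> matter.\<close>

definition contracts :: "nat \<Rightarrow> (nat \<Rightarrow> real) set" where
  "contracts m = {t. \<forall>j\<in>{1..m}. 0 \<le> t j}"

definition linear_contract :: "(nat \<Rightarrow> real) \<Rightarrow> real \<Rightarrow> nat \<Rightarrow> real" where
  "linear_contract r \<alpha> j = \<alpha> * r j"


section \<open>Well-definedness\<close>

text \<open>The best response exists, and the principal's value is bounded by \<open>r m\<close>, so suprema of it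
  over sets of contracts are genuine real suprema.\<close>

lemma finite_histories:
  assumes "finite A" shows "finite (histories A m)"
proof (rule finite_subset)
  show "histories A m \<subseteq> {h. set h \<subseteq> A \<times> {1..m} \<and> length h \<le> card A}"
  proof
    fix h assume h: "h \<in> histories A m"
    then have "length h = card (fst ` set h)"
      using distinct_card[of "map fst h"] by (simp add: histories_def)
    also have "\<dots> \<le> card A"
      using h assms by (intro card_mono) (auto simp: histories_def)
    finally show "h \<in> {h. set h \<subseteq> A \<times> {1..m} \<and> length h \<le> card A}"
      using h by (auto simp: histories_def)
  qed
  show "finite {h. set h \<subseteq> A \<times> {1..m} \<and> length h \<le> card A}"
    using assms by (intro finite_lists_length_le) auto
qed

lemma finite_strategies:
  assumes "finite A" shows "finite (strategies A m)"
  unfolding strategies_def decisions_def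
  using assms by (intro finite_PiE finite_histories) auto

lemma strategies_nonempty: "strategies A m \<noteq> {}"
  unfolding strategies_def decisions_def by (auto simp: PiE_eq_empty_iff)

lemma play_histories:
  assumes "\<pi> \<in> strategies A m" "\<And>i. i \<in> A \<Longrightarrow> x i \<in> {1..m}"
  shows "play \<pi> x k \<in> histories A m"
proof (induction k)
  case 0
  then show ?case by (simp add: histories_def)
next
  case (Suc k)
  then have d: "\<pi> (play \<pi> x k) \<in> decisions A (play \<pi> x k)"
    using assms(1) unfolding strategies_def by blast
  show ?case
  proof (cases "\<pi> (play \<pi> x k)")
    case (Take i)
    with d have "i \<in> A" "i \<notin> fst ` set (play \<pi> x k)" by (auto simp: decisions_def)
    with Suc Take assms(2)[of i] show ?thesis by (auto simp: histories_def)
  qed (use Suc in simp)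
qed

lemma play_step:
  "(\<exists>j. \<pi> (play \<pi> x k) = Halt j) \<or> length (play \<pi> x k) = k"
  by (induction k) (auto split: decision.splits)

lemma play_halts:
  assumes "finite A" "\<pi> \<in> strategies A m" "\<And>i. i \<in> A \<Longrightarrow> x i \<in> {1..m}"
  shows "\<exists>j \<in> insert 1 (snd ` set (play \<pi> x (card A))). \<pi> (play \<pi> x (card A)) = Halt j"
proof -
  define h where "h = play \<pi> x (card A)"
  have h: "h \<in> histories A m" unfolding h_def using play_histories assms(2,3) .
  then have d: "\<pi> h \<in> decisions A h" using assms(2) unfolding strategies_def by blast
  have "\<exists>j. \<pi> h = Halt j"
  proof (rule ccontr)
    assume n: "\<not> ?thesis"
    then have "length h = card A" using play_step unfolding h_def by blast
    then have "card (fst ` set h) = card A"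
      using h distinct_card[of "map fst h"] by (simp add: histories_def)
    moreover have "fst ` set h \<subseteq> A" using h by (auto simp: histories_def)
    ultimately have "fst ` set h = A" using assms(1) by (simp add: card_subset_eq)
    with d n show False by (auto simp: decisions_def)
  qed
  with d show ?thesis unfolding h_def decisions_def by auto
qed

context sequential_contract
begin

lemma final_outcome_range:
  assumes "\<pi> \<in> strategies A m" "x \<in> set_pmf outcome_law"
  shows "final_outcome A \<pi> x \<in> {1..m}"
proof -
  have x: "x i \<in> {1..m}" if "i \<in> A" for i
  proof -
    have "x i \<in> set_pmf (p i)"
      using assms(2) that finite_actions by (simp add: outcome_law_def set_Pi_pmf PiE_dflt_def)
    then show ?thesis using outcome_range[OF that] by blast
  qed
  define h where "h = play \<pi> x (card A)"
  have "\<exists>j \<in> insert 1 (snd ` set h). \<pi> h = Halt j"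
    unfolding h_def by (rule play_halts[OF finite_actions assms(1) x])
  then obtain j where j: "j \<in> insert 1 (snd ` set h)" "\<pi> h = Halt j" ..
  have "h \<in> histories A m"
    unfolding h_def by (rule play_histories[OF assms(1) x])
  then have "snd ` set h \<subseteq> {1..m}" by (auto simp: histories_def)
  then have "j \<in> {1..m}" using j(1) outcomes_nonempty by auto
  then show ?thesis using j(2) by (simp add: final_outcome_def h_def)
qed

lemma favoured_optimal_nonempty: "favoured_optimal t \<noteq> {}"
proof -
  have fin: "finite (strategies A m)" using finite_strategies finite_actions .
  have "Max (agent_utility t ` strategies A m) \<in> agent_utility t ` strategies A m"
    using fin strategies_nonempty by (intro Max_in) auto
  then obtain \<pi> where "\<pi> \<in> strategies A m" "agent_utility t \<pi> = Max (agent_utility t ` strategies A m)"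
    by force
  then have "\<pi> \<in> agent_optimal t" using fin by (auto simp: agent_optimal_def)
  moreover have fin': "finite (agent_optimal t)" using fin by (simp add: agent_optimal_def)
  ultimately have "Max (principal_utility t ` agent_optimal t) \<in> principal_utility t ` agent_optimal t"
    by (intro Max_in) auto
  then obtain \<rho> where "\<rho> \<in> agent_optimal t"
    "principal_utility t \<rho> = Max (principal_utility t ` agent_optimal t)"
    by force
  then have "\<rho> \<in> favoured_optimal t" using fin' by (auto simp: favoured_optimal_def)
  then show ?thesis by blast
qed

lemma linear_order_least:
  assumes "linear_order_on S R" "finite F" "F \<noteq> {}" "F \<subseteq> S"
  shows "\<exists>a\<in>F. \<forall>b\<in>F. (a, b) \<in> R"
  using assms(2-4)
proof (induction F rule: finite_ne_induct)
  case (singleton a)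
  then show ?case
    using assms(1) by (auto simp: linear_order_on_def partial_order_on_def preorder_on_def refl_on_def)
next
  case (insert y F)
  then obtain a where a: "a \<in> F" "\<forall>b\<in>F. (a, b) \<in> R" by blast
  have refl: "\<And>s. s \<in> S \<Longrightarrow> (s, s) \<in> R" and tr: "trans R" and tot: "total_on S R"
    using assms(1) by (auto simp: linear_order_on_def partial_order_on_def preorder_on_def refl_on_def)
  have "(a, y) \<in> R \<or> (y, a) \<in> R"
    using tot insert.prems a(1) refl unfolding total_on_def by (cases "a = y") auto
  then show ?case
  proof
    assume "(a, y) \<in> R"
    with a show ?thesis by auto
  next
    assume "(y, a) \<in> R"
    with a tr have "\<forall>b\<in>F. (y, b) \<in> R" by (meson transD)
    moreover have "(y, y) \<in> R" using refl insert.prems by simp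
    ultimately show ?thesis by auto
  qed
qed

lemma best_response_favoured:
  "best_response t \<in> favoured_optimal t \<and> (\<forall>\<pi>'\<in>favoured_optimal t. (best_response t, \<pi>') \<in> tie)"
proof -
  have sub: "favoured_optimal t \<subseteq> strategies A m"
    by (auto simp: favoured_optimal_def agent_optimal_def)
  obtain a where a: "a \<in> favoured_optimal t" "\<forall>b\<in>favoured_optimal t. (a, b) \<in> tie"
    using linear_order_least[OF tie_order finite_subset[OF sub finite_strategies[OF finite_actions]]
        favoured_optimal_nonempty sub] by blast
  have "antisym tie" using tie_order by (simp add: linear_order_on_def partial_order_on_def)
  with a have "\<exists>!\<pi>. \<pi> \<in> favoured_optimal t \<and> (\<forall>\<pi>'\<in>favoured_optimal t. (\<pi>, \<pi>') \<in> tie)"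
    by (intro ex1I[of _ a]) (auto dest: antisymD)
  from theI'[OF this] show ?thesis unfolding best_response_def .
qed

lemma principal_value_le:
  assumes "t \<in> contracts m"
  shows "principal_value t \<le> r m"
proof -
  let ?\<pi> = "best_response t"
  have \<pi>: "?\<pi> \<in> strategies A m"
    using best_response_favoured[of t] by (auto simp: favoured_optimal_def agent_optimal_def)
  have "finite (set_pmf outcome_law)"
    unfolding outcome_law_def
    using finite_subset[OF outcome_range] finite_actions
    by (simp add: set_Pi_pmf finite_PiE_dflt)
  moreover have "r (final_outcome A ?\<pi> x) - t (final_outcome A ?\<pi> x) \<le> r m"
    if "x \<in> set_pmf outcome_law" for x
  proof -
    have f: "final_outcome A ?\<pi> x \<in> {1..m}" using final_outcome_range[OF \<pi> that] .
    then have "r (final_outcome A ?\<pi> x) \<le> r m"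
      using reward_mono outcomes_nonempty by (intro mono_onD[of "{1..m}" r]) auto
    moreover have "0 \<le> t (final_outcome A ?\<pi> x)" using f assms unfolding contracts_def by blast
    ultimately show ?thesis by linarith
  qed
  ultimately show ?thesis
    unfolding principal_value_def principal_utility_def
    by (intro measure_pmf.integral_le_const integrable_measure_pmf_finite) (auto simp: AE_measure_pmf_iff)
qed

lemma bdd_above_principal_value: "bdd_above (principal_value ` contracts m)"
  using principal_value_le by (rule bdd_aboveI2)

lemma linear_contract_in_contracts:
  assumes "\<alpha> \<in> {0..1}"
  shows "linear_contract r \<alpha> \<in> contracts m"
proof -
  have "0 \<le> r j" if "j \<in> {1..m}" for j
    using mono_onD[OF reward_mono, of 1 j] that reward_first by simp
  with assms show ?thesis by (simp add: contracts_def linear_contract_def)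
qed

end

end

theory Submission
  imports Defs
begin

text \<open>
  Under the contract \<open>\<alpha> \<cdot> r\<close> the agent plays Pandora's box, so by Weitzman's theorem his best utility is
  \<open>U \<alpha> = E max (0, max\<^sub>i min (\<alpha> r (X\<^sub>i)) (k\<^sub>i \<alpha>))\<close>, where the index \<open>k\<^sub>i \<alpha>\<close> solves
  \<open>E (\<alpha> r (X\<^sub>i) - k)\<^sup>+ = c\<^sub>i\<close>. As a function of \<open>\<alpha>\<close> each \<open>k\<^sub>i\<close> is a maximum of at most \<open>m\<close> affine
  functions, so \<open>[0, 1]\<close> splits into \<open>O(n\<^sup>2 m)\<close> pieces on which all \<open>k\<^sub>i\<close> are affine and the order of
  the functions \<open>k\<^sub>i\<close> and \<open>\<alpha> r (j)\<close> is constant; there \<open>U\<close> is affine. On such a piece \<open>[a, b]\<close> the slope of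
  \<open>U\<close> is the expected reward of the best response at the midpoint \<open>d\<close>, and \<open>b - a \<le> 2 (1 - d)\<close>, so
  \<open>U\<close> increases by at most twice the principal's utility at \<open>d\<close>. Since \<open>U 0 = 0\<close> and \<open>U 1\<close> is the
  maximal welfare, which bounds the principal's utility under every contract, the claim follows.
\<close>

subsection \<open>Auxiliary facts\<close>

text \<open>The endpoints of the intervals are at most \<open>2 * card \<I>\<close> cut points.
  Between neighbouring cut points a closed interval that meets the interior of a piece covers the
  whole closed piece, so \<open>piece\<close> applies there, and the increments add up.\<close>

lemma increment_le_card_pieces:
  fixes u :: "real \<Rightarrow> real" and \<I> :: "real set set"
  assumes "finite \<I>" "\<And>I. I \<in> \<I> \<Longrightarrow> \<exists>l h. I = {l..h}" "0 \<le> D"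
    and piece: "\<And>a b. \<lbrakk>s \<le> a; a < b; b \<le> t;
           \<And>I y. \<lbrakk>I \<in> \<I>; y \<in> I; a < y; y < b\<rbrakk> \<Longrightarrow> {a..b} \<subseteq> I\<rbrakk> \<Longrightarrow> u b - u a \<le> D"
    and "s \<le> t"
  shows "u t - u s \<le> (2 * real (card \<I>) + 1) * D"
proof -
  obtain l h where lh: "\<And>I. I \<in> \<I> \<Longrightarrow> I = {l I..h I}"
    using assms(2) by metis
  define B where "B = l ` \<I> \<union> h ` \<I>"
  have fB: "finite B" using assms(1) by (simp add: B_def)
  have "card B \<le> card (l ` \<I>) + card (h ` \<I>)" unfolding B_def by (rule card_Un_le)
  also have "\<dots> \<le> 2 * card \<I>" using card_image_le[OF assms(1)] by (smt (verit) add_mono mult_2)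
  finally have cB: "card B \<le> 2 * card \<I>" .
  \<comment> \<open>Arbitrary subintervals allow a split at any inner cut point \<open>z\<close>. As
    \<open>z\<close> is interior to neither half, both counts drop, and the \<open>+ 1\<close> of
    the second half pays for \<open>z\<close>.\<close>
  have main: "u b - u a \<le> (real (card (B \<inter> {a<..<b})) + 1) * D" if "s \<le> a" "a \<le> b" "b \<le> t" for a b
    using that
  proof (induction "card (B \<inter> {a<..<b})" arbitrary: a b rule: less_induct)
    case less
    show ?case
    proof (cases "B \<inter> {a<..<b} = {}")
      case True
      have "u b - u a \<le> D"
      proof (cases "a = b")
        case False
        show ?thesis
        proof (rule piece)
          fix I y assume I: "I \<in> \<I>" "y \<in> I" "a < y" "y < b"
          have "l I \<in> B" "h I \<in> B" using I(1) by (auto simp: B_def)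
          with True have "l I \<notin> {a<..<b}" "h I \<notin> {a<..<b}" by auto
          moreover have "y \<in> {l I..h I}" using I(2) lh[OF I(1)] by blast
          ultimately have "{a..b} \<subseteq> {l I..h I}" using I(3,4) by auto
          also have "\<dots> = I" using lh[OF I(1)] by (rule sym)
          finally show "{a..b} \<subseteq> I" .
        qed (use less False in auto)
      qed (use assms in simp)
      then show ?thesis using True by simp
    next
      case False
      then obtain z where z: "z \<in> B" "a < z" "z < b" by auto
      have ins: "B \<inter> {a<..<b} = insert z (B \<inter> {a<..<z} \<union> B \<inter> {z<..<b})" using z by auto
      have card: "card (B \<inter> {a<..<b}) = Suc (card (B \<inter> {a<..<z}) + card (B \<inter> {z<..<b}))"
        unfolding ins using fB by (subst card_insert_disjoint) (auto intro!: card_Un_disjoint)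
      have "u z - u a \<le> (real (card (B \<inter> {a<..<z})) + 1) * D"
        by (rule less(1)) (use card z less(2-4) in auto)
      moreover have "u b - u z \<le> (real (card (B \<inter> {z<..<b})) + 1) * D"
        by (rule less(1)) (use card z less(2-4) in auto)
      ultimately show ?thesis unfolding card by (simp add: algebra_simps)
    qed
  qed
  have "card (B \<inter> {s<..<t}) \<le> card B" using fB by (intro card_mono) auto
  then have "real (card (B \<inter> {s<..<t})) + 1 \<le> 2 * real (card \<I>) + 1" using cB by linarith
  then show ?thesis using main[of s t] assms(3,5) by (smt (verit) mult_right_mono)
qed

text \<open>A compact convex subset of the line is a closed interval; the empty set is the case
  \<open>h < l\<close>.\<close>

lemma polyhedron_in_unit_interval:
  fixes s q :: "'a \<Rightarrow> real"
  shows "\<exists>l h. {x \<in> {0..1}. \<forall>i\<in>L. s i * x \<le> q i} = {l..h}"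
proof -
  let ?S = "{x \<in> {0..1}. \<forall>i\<in>L. s i * x \<le> q i}"
  have eq: "?S = {0..1} \<inter> (\<Inter>i\<in>L. {x. s i * x \<le> q i})" by auto
  have "closed (\<Inter>i\<in>L. {x. s i * x \<le> q i})"
    by (intro closed_INT ballI closed_Collect_le continuous_intros)
  then have "compact ?S" unfolding eq by (intro compact_Int_closed) auto
  moreover have "convex {x. s i * x \<le> q i}" for i
    using convex_halfspace_le[of "s i" "q i"] by (simp add: inner_real_def)
  then have "convex ?S" unfolding eq by (intro convex_Int convex_INT) auto
  ultimately show ?thesis
    by (intro connected_compact_interval_1[THEN iffD1] conjI convex_connected)
qed

text \<open>If any two members compare the same way throughout \<open>T\<close>, one member
  dominates all others on all of \<open>T\<close>. A pointwise maximum of affine functions is then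
  itself affine there.\<close>

lemma Max_of_chain:
  fixes G :: "('a \<Rightarrow> 'b::linorder) set"
  assumes "finite G" "G \<noteq> {}"
    and "\<And>f g. \<lbrakk>f \<in> G; g \<in> G\<rbrakk> \<Longrightarrow> (\<forall>x\<in>T. f x \<le> g x) \<or> (\<forall>x\<in>T. g x \<le> f x)"
  shows "\<exists>g\<in>G. \<forall>x\<in>T. Max ((\<lambda>f. f x) ` G) = g x"
proof -
  have "\<exists>g\<in>G. \<forall>f\<in>G. \<forall>x\<in>T. f x \<le> g x"
    using assms
  proof (induction G rule: finite_ne_induct)
    case (insert f G)
    then obtain g where g: "g \<in> G" "\<forall>f\<in>G. \<forall>x\<in>T. f x \<le> g x" by blast
    consider "\<forall>x\<in>T. f x \<le> g x" | "\<forall>x\<in>T. g x \<le> f x" using insert.prems[of f g] g(1) by blast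
    then show ?case
    proof cases
      case 1
      with g show ?thesis by (intro bexI[of _ g]) auto
    next
      case 2
      then have "\<forall>f'\<in>G. \<forall>x\<in>T. f' x \<le> f x" using g(2) order_trans by blast
      then show ?thesis by (intro bexI[of _ f]) auto
    qed
  qed simp
  then obtain g where "g \<in> G" "\<forall>f\<in>G. \<forall>x\<in>T. f x \<le> g x" ..
  with assms(1) show ?thesis by (intro bexI[of _ g] ballI Max_eqI) auto
qed

section \<open>Independence of the decision to take an action from its outcome\<close>

lemma play_cong:
  assumes "\<And>i. i \<in> fst ` set (play \<pi> x k) \<Longrightarrow> x' i = x i"
  shows "play \<pi> x' k = play \<pi> x k"
  using assms
proof (induction k)
  case (Suc k)
  have "x' i = x i" if "i \<in> fst ` set (play \<pi> x k)" for i
    using Suc.prems[of i] that by (cases "\<pi> (play \<pi> x k)") auto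
  then have "play \<pi> x' k = play \<pi> x k" by (rule Suc.IH)
  with Suc.prems show ?case by (cases "\<pi> (play \<pi> x k)") auto
qed simp

lemma play_fun_upd:
  "i \<notin> fst ` set (play \<pi> x k) \<Longrightarrow> play \<pi> (x(i := y)) k = play \<pi> x k"
  by (rule play_cong) auto

text \<open>Up to the moment when \<open>i\<close> is taken its outcome has not been seen. The
  converse direction comes from restoring the old value.\<close>

lemma taken_fun_upd: "i \<in> taken A \<pi> (x(i := y)) \<longleftrightarrow> i \<in> taken A \<pi> x"
proof
  show "i \<in> taken A \<pi> x" if "i \<in> taken A \<pi> (x(i := y))"
    using that play_fun_upd[of i \<pi> x "card A" y] unfolding taken_def by metis
  show "i \<in> taken A \<pi> (x(i := y))" if "i \<in> taken A \<pi> x"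
    using that play_fun_upd[of i \<pi> "x(i := y)" "card A" "x i"] unfolding taken_def
    by (metis fun_upd_triv fun_upd_upd)
qed

lemma snd_play: "snd ` set (play \<pi> x k) = x ` fst ` set (play \<pi> x k)"
  by (induction k) (auto split: decision.splits)

text \<open>\<open>g\<close> ignores coordinate \<open>i\<close>, so under the product law it is
  independent of \<open>x i\<close>.\<close>

lemma expectation_Pi_pmf_separate:
  fixes f g :: "_ \<Rightarrow> real"
  assumes "finite A" "i \<in> A" "\<And>j. j \<in> A \<Longrightarrow> finite (set_pmf (p j))"
    and g: "\<And>x y. g (x(i := y)) = g x"
  shows "measure_pmf.expectation (Pi_pmf A d p) (\<lambda>x. g x * f (x i)) =
    measure_pmf.expectation (Pi_pmf A d p) g * measure_pmf.expectation (p i) f"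
proof -
  let ?E = measure_pmf.expectation
  define Q where "Q = Pi_pmf (A - {i}) d p"
  have fin: "finite (set_pmf Q)" "finite (set_pmf (p i))"
    using assms by (auto simp: Q_def set_Pi_pmf intro!: finite_PiE_dflt)
  have law: "Pi_pmf A d p = map_pmf (\<lambda>(y, x). x(i := y)) (pair_pmf (p i) Q)"
    using Pi_pmf_insert[of "A - {i}" i d p] assms(1,2) by (simp add: Q_def insert_absorb)
  have prod: "?E (pair_pmf (p i) Q) (\<lambda>(y, x). g x * h y) = ?E Q g * ?E (p i) h" for h :: "_ \<Rightarrow> real"
  proof -
    have "?E (pair_pmf (p i) Q) (\<lambda>(y, x). g x * h y) =
        (\<Sum>(y, x)\<in>set_pmf (p i) \<times> set_pmf Q. (g x * h y) * (pmf (p i) y * pmf Q x))"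
      using fin by (subst integral_measure_pmf_real[where A="set_pmf (p i) \<times> set_pmf Q"])
        (auto simp: pmf_pair split_def intro!: sum.cong)
    also have "\<dots> = (\<Sum>x\<in>set_pmf Q. g x * pmf Q x) * (\<Sum>y\<in>set_pmf (p i). h y * pmf (p i) y)"
      unfolding sum.cartesian_product[symmetric] sum_product
      by (subst sum.swap) (simp only: mult_ac)
    also have "\<dots> = ?E Q g * ?E (p i) h"
      using fin by (simp add: integral_measure_pmf_real[where A="set_pmf (p i)"]
          integral_measure_pmf_real[where A="set_pmf Q"])
    finally show ?thesis .
  qed
  have "?E (Pi_pmf A d p) (\<lambda>x. g x * h (x i)) = ?E Q g * ?E (p i) h" for h :: "_ \<Rightarrow> real"
    unfolding law integral_map_pmf prod[symmetric]
    by (intro Bochner_Integration.integral_cong) (auto simp: g)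
  \<comment> \<open>The choice \<open>h = 1\<close> identifies the expectation of \<open>g\<close>
    under \<open>Q\<close> with that under the full law.\<close>
  from this[of f] this[of "\<lambda>_. 1"] show ?thesis by simp
qed

subsection \<open>Weitzman's index policy\<close>

context sequential_contract
begin

section \<open>Basic facts about the outcome law\<close>

lemma reward_nonneg: "j \<in> {1..m} \<Longrightarrow> 0 \<le> r j"
  using mono_onD[OF reward_mono, of 1 j] reward_first by simp

lemma realization_range: "\<lbrakk>x \<in> set_pmf outcome_law; i \<in> A\<rbrakk> \<Longrightarrow> x i \<in> {1..m}"
  using outcome_range[of i] finite_actions by (auto simp: outcome_law_def set_Pi_pmf PiE_dflt_def)

lemma finite_outcome: "i \<in> A \<Longrightarrow> finite (set_pmf (p i))"
  using outcome_range finite_subset by blast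

lemma finite_outcome_law: "finite (set_pmf outcome_law)"
  using finite_outcome finite_actions by (simp add: outcome_law_def set_Pi_pmf finite_PiE_dflt)

lemma integrable_outcome_law [simp, intro]: "integrable (measure_pmf outcome_law) (f :: _ \<Rightarrow> real)"
  by (simp add: finite_outcome_law integrable_measure_pmf_finite)

lemma expectation_mono:
  fixes f g :: "_ \<Rightarrow> real"
  assumes "\<And>x. x \<in> set_pmf outcome_law \<Longrightarrow> f x \<le> g x"
  shows "measure_pmf.expectation outcome_law f \<le> measure_pmf.expectation outcome_law g"
  using assms by (intro integral_mono_AE) (auto simp: AE_measure_pmf_iff)

lemma play_in_histories:
  "\<lbrakk>\<pi> \<in> strategies A m; x \<in> set_pmf outcome_law\<rbrakk> \<Longrightarrow> play \<pi> x k \<in> histories A m"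
  using play_histories realization_range by blast

lemma taken_subset: "\<lbrakk>\<pi> \<in> strategies A m; x \<in> set_pmf outcome_law\<rbrakk> \<Longrightarrow> taken A \<pi> x \<subseteq> A"
  using play_in_histories[of \<pi> x "card A"] by (auto simp: taken_def histories_def)

text \<open>These are Weitzman's reservation values: with \<open>\<kappa> i\<close> in hand, taking
  \<open>i\<close> just breaks even. A predicate is used because the value is not unique when
  \<open>c i = 0\<close>.\<close>

definition index_law :: "(nat \<Rightarrow> real) \<Rightarrow> (nat \<Rightarrow> real) \<Rightarrow> bool" where
  "index_law v \<kappa> \<longleftrightarrow> (\<forall>i\<in>A. measure_pmf.expectation (p i) (\<lambda>j. max 0 (v j - \<kappa> i)) = c i)"

text \<open>The inserted 0 stands for outcome 1, which is always revealed.\<close>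

definition capped_max :: "(nat \<Rightarrow> real) \<Rightarrow> (nat \<Rightarrow> real) \<Rightarrow> (nat \<Rightarrow> nat) \<Rightarrow> real" where
  "capped_max v \<kappa> x = Max (insert 0 ((\<lambda>i. min (v (x i)) (\<kappa> i)) ` A))"

text \<open>Whether \<open>i\<close> is taken does not depend on \<open>X\<^sub>i\<close>, so the cost \<open>c\<^sub>i\<close> may be charged as the excess of the
  value of \<open>X\<^sub>i\<close> over the index.\<close>

lemma agent_utility_amortized:
  assumes "index_law v \<kappa>" and \<pi>: "\<pi> \<in> strategies A m"
  shows "agent_utility v \<pi> = measure_pmf.expectation outcome_law
    (\<lambda>x. v (final_outcome A \<pi> x) - (\<Sum>i\<in>taken A \<pi> x. max 0 (v (x i) - \<kappa> i)))"
proof -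
  let ?E = "measure_pmf.expectation outcome_law"
  have sum: "?E (\<lambda>x. \<Sum>i\<in>taken A \<pi> x. f i x) = (\<Sum>i\<in>A. ?E (\<lambda>x. of_bool (i \<in> taken A \<pi> x) * f i x))"
    for f :: "nat \<Rightarrow> (nat \<Rightarrow> nat) \<Rightarrow> real"
  proof -
    have "?E (\<lambda>x. \<Sum>i\<in>taken A \<pi> x. f i x) = ?E (\<lambda>x. \<Sum>i\<in>A. of_bool (i \<in> taken A \<pi> x) * f i x)"
    proof (intro integral_cong_AE)
      have "(\<Sum>i\<in>taken A \<pi> x. f i x) = (\<Sum>i\<in>A. of_bool (i \<in> taken A \<pi> x) * f i x)"
        if "x \<in> set_pmf outcome_law" for x
        using taken_subset[OF \<pi> that] finite_actions
        by (intro sum.mono_neutral_cong_left) auto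
      then show "AE x in outcome_law. (\<Sum>i\<in>taken A \<pi> x. f i x) =
          (\<Sum>i\<in>A. of_bool (i \<in> taken A \<pi> x) * f i x)"
        by (auto simp: AE_measure_pmf_iff)
    qed auto
    then show ?thesis by simp
  qed
  have "?E (\<lambda>x. of_bool (i \<in> taken A \<pi> x) * c i) =
      ?E (\<lambda>x. of_bool (i \<in> taken A \<pi> x) * max 0 (v (x i) - \<kappa> i))" if "i \<in> A" for i
    using expectation_Pi_pmf_separate[of A i p "\<lambda>x. of_bool (i \<in> taken A \<pi> x)" 1
        "\<lambda>j. max 0 (v j - \<kappa> i)"] finite_actions that finite_outcome assms(1)
    by (simp add: taken_fun_upd index_law_def outcome_law_def)
  then have "?E (\<lambda>x. \<Sum>i\<in>taken A \<pi> x. c i) = ?E (\<lambda>x. \<Sum>i\<in>taken A \<pi> x. max 0 (v (x i) - \<kappa> i))"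
    unfolding sum by simp
  then show ?thesis unfolding agent_utility_def by simp
qed

lemma final_outcome_revealed:
  assumes "\<pi> \<in> strategies A m" "x \<in> set_pmf outcome_law"
  shows "final_outcome A \<pi> x \<in> insert 1 (x ` taken A \<pi> x)"
    and "\<pi> (play \<pi> x (card A)) = Halt (final_outcome A \<pi> x)"
proof -
  obtain j where j: "j \<in> insert 1 (snd ` set (play \<pi> x (card A)))" "\<pi> (play \<pi> x (card A)) = Halt j"
    using play_halts[OF finite_actions assms(1)] realization_range[OF assms(2)] by blast
  then show "\<pi> (play \<pi> x (card A)) = Halt (final_outcome A \<pi> x)" by (simp add: final_outcome_def)
  show "final_outcome A \<pi> x \<in> insert 1 (x ` taken A \<pi> x)"
    using j by (simp add: final_outcome_def taken_def snd_play)
qed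

text \<open>The bound holds for each realization: the selected action \<open>i\<close> alone is
  charged \<open>max 0 (v (x i) - \<kappa> i)\<close>, which leaves
  \<open>min (v (x i)) (\<kappa> i)\<close>, and all other charges are nonnegative.\<close>

lemma agent_utility_le_capped_max:
  assumes "index_law v \<kappa>" "v 1 = 0" and \<pi>: "\<pi> \<in> strategies A m"
  shows "agent_utility v \<pi> \<le> measure_pmf.expectation outcome_law (capped_max v \<kappa>)"
  unfolding agent_utility_amortized[OF assms(1,3)]
proof (rule expectation_mono)
  fix x assume x: "x \<in> set_pmf outcome_law"
  let ?T = "taken A \<pi> x" and ?f = "\<lambda>i. max 0 (v (x i) - \<kappa> i)"
  have T: "?T \<subseteq> A" "finite ?T" using taken_subset[OF \<pi> x] finite_actions finite_subset by auto
  show "v (final_outcome A \<pi> x) - sum ?f ?T \<le> capped_max v \<kappa> x"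
    using final_outcome_revealed(1)[OF \<pi> x]
  proof
    assume "final_outcome A \<pi> x = 1"
    moreover have "0 \<le> sum ?f ?T" by (intro sum_nonneg) auto
    moreover have "0 \<le> capped_max v \<kappa> x" using finite_actions by (simp add: capped_max_def)
    ultimately show ?thesis using assms(2) by simp
  next
    assume "final_outcome A \<pi> x \<in> x ` ?T"
    then obtain i where i: "i \<in> ?T" "final_outcome A \<pi> x = x i" by blast
    have "?f i \<le> sum ?f ?T" using i T(2) by (intro member_le_sum) auto
    moreover have "min (v (x i)) (\<kappa> i) \<le> capped_max v \<kappa> x"
      unfolding capped_max_def using i T finite_actions by (intro Max_ge) auto
    ultimately show ?thesis unfolding i(2) by linarith
  qed
qed

section \<open>The index strategy and its optimality\<close>

definition best_revealed :: "(nat \<Rightarrow> real) \<Rightarrow> history \<Rightarrow> nat" where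
  "best_revealed v h = arg_min_on (\<lambda>j. - v j) (insert 1 (snd ` set h))"

definition untaken_argmax :: "(nat \<Rightarrow> real) \<Rightarrow> history \<Rightarrow> nat" where
  "untaken_argmax \<kappa> h = arg_min_on (\<lambda>i. - \<kappa> i) (A - fst ` set h)"

definition index_strategy :: "(nat \<Rightarrow> real) \<Rightarrow> (nat \<Rightarrow> real) \<Rightarrow> strategy" where
  "index_strategy v \<kappa> = (\<lambda>h\<in>histories A m.
     if A \<subseteq> fst ` set h \<or> \<kappa> (untaken_argmax \<kappa> h) \<le> v (best_revealed v h)
     then Halt (best_revealed v h) else Take (untaken_argmax \<kappa> h))"

lemma best_revealed_in: "best_revealed v h \<in> insert 1 (snd ` set h)"
  and best_revealed_ge: "j \<in> insert 1 (snd ` set h) \<Longrightarrow> v j \<le> v (best_revealed v h)"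
  unfolding best_revealed_def
  using arg_min_if_finite(1)[of "insert 1 (snd ` set h)" "\<lambda>j. - v j"]
    arg_min_least[of "insert 1 (snd ` set h)" j "\<lambda>j. - v j"] by auto

lemma untaken_argmax_in: "\<not> A \<subseteq> fst ` set h \<Longrightarrow> untaken_argmax \<kappa> h \<in> A - fst ` set h"
  unfolding untaken_argmax_def using finite_actions by (intro arg_min_if_finite) auto

lemma untaken_argmax_ge: "i \<in> A - fst ` set h \<Longrightarrow> \<kappa> i \<le> \<kappa> (untaken_argmax \<kappa> h)"
  unfolding untaken_argmax_def
  using finite_actions arg_min_least[of "A - fst ` set h" i "\<lambda>i. - \<kappa> i"] by auto

lemma index_strategy_in: "index_strategy v \<kappa> \<in> strategies A m"
  unfolding strategies_def index_strategy_def decisions_def restrict_PiE_iff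
  using best_revealed_in[of v] untaken_argmax_in[of _ \<kappa>]
  by (auto simp: image_iff split: if_splits)

lemma index_strategy_halt:
  assumes "h \<in> histories A m" "index_strategy v \<kappa> h = Halt j"
  shows "j = best_revealed v h" "i \<in> A - fst ` set h \<Longrightarrow> \<kappa> i \<le> v j"
  using assms untaken_argmax_ge[of i h \<kappa>] unfolding index_strategy_def
  by (auto split: if_splits)

lemma index_strategy_take:
  assumes "h \<in> histories A m" "index_strategy v \<kappa> h = Take i"
  shows "i \<in> A - fst ` set h" "\<And>i'. i' \<in> A - fst ` set h \<Longrightarrow> \<kappa> i' \<le> \<kappa> i"
    "v (best_revealed v h) < \<kappa> i"
  using assms untaken_argmax_ge[of _ h \<kappa>] untaken_argmax_in[of h \<kappa>] unfolding index_strategy_def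
  by (auto split: if_splits)

text \<open>An excess over the index occurs only for the last action taken: afterwards its outcome beats every
  remaining index.\<close>

lemma index_strategy_invariant:
  fixes v \<kappa> :: "nat \<Rightarrow> real"
  defines "\<sigma> \<equiv> index_strategy v \<kappa>"
  assumes x: "x \<in> set_pmf outcome_law" and "v 1 = 0"
  shows "(\<forall>i\<in>fst ` set (play \<sigma> x k). v (x i) \<le> \<kappa> i) \<or>
    (\<exists>i\<in>fst ` set (play \<sigma> x k). \<kappa> i < v (x i) \<and> 0 \<le> \<kappa> i \<and>
       (\<forall>i'\<in>fst ` set (play \<sigma> x k) - {i}. v (x i') \<le> \<kappa> i' \<and> v (x i') \<le> \<kappa> i) \<and>
       (\<forall>i'\<in>A - fst ` set (play \<sigma> x k). \<kappa> i' \<le> \<kappa> i))"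
proof (induction k)
  case (Suc k)
  let ?h = "play \<sigma> x k"
  have h: "?h \<in> histories A m"
    using play_in_histories[OF index_strategy_in x] by (simp add: \<sigma>_def)
  have rev: "v (x i) \<le> v (best_revealed v ?h)" if "i \<in> fst ` set ?h" for i
    using that by (intro best_revealed_ge insertI2) (simp add: snd_play)
  have rev0: "0 \<le> v (best_revealed v ?h)" using best_revealed_ge[of 1 ?h v] assms(3) by simp
  show ?case
  proof (cases "\<sigma> ?h")
    case (Halt j)
    then show ?thesis using Suc by simp
  next
    case (Take i)
    have t: "i \<in> A - fst ` set ?h" "\<And>i'. i' \<in> A - fst ` set ?h \<Longrightarrow> \<kappa> i' \<le> \<kappa> i"
      "v (best_revealed v ?h) < \<kappa> i"
      using index_strategy_take[OF h] Take unfolding \<sigma>_def by blast+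
    \<comment> \<open>An earlier excess at some action would put the best revealed value above that
      action's index, hence above every remaining index, and the strategy would have halted instead
      of taking \<open>i\<close>.\<close>
    have le: "v (x i') \<le> \<kappa> i'" if "i' \<in> fst ` set ?h" for i'
      using Suc
    proof
      assume "\<exists>i\<in>fst ` set ?h. \<kappa> i < v (x i) \<and> 0 \<le> \<kappa> i \<and>
       (\<forall>i'\<in>fst ` set ?h - {i}. v (x i') \<le> \<kappa> i' \<and> v (x i') \<le> \<kappa> i) \<and>
       (\<forall>i'\<in>A - fst ` set ?h. \<kappa> i' \<le> \<kappa> i)"
      then show ?thesis using t(1,3) rev by (smt (verit, best))
    qed (use that in blast)
    have S: "fst ` set (play \<sigma> x (Suc k)) = insert i (fst ` set ?h)" using Take by simp
    have le': "v (x i') \<le> \<kappa> i" if "i' \<in> fst ` set ?h" for i'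
      using rev[OF that] t(3) by linarith
    show ?thesis
    proof (cases "v (x i) \<le> \<kappa> i")
      case True
      then show ?thesis unfolding S using le by blast
    next
      case False
      then have "\<kappa> i < v (x i)" "0 \<le> \<kappa> i" using t(3) rev0 by linarith+
      then show ?thesis unfolding S using le le' t(2) by blast
    qed
  qed
qed simp

text \<open>Again for each realization. Without an excess nothing is charged, and the final value
  bounds all revealed values and all remaining indices. With an excess at \<open>i\<close>, the
  payoff after the charge is still at least \<open>\<kappa> i\<close>, which bounds every capped
  value by the invariant.\<close>

lemma index_strategy_ge_capped_max:
  assumes "index_law v \<kappa>" "v 1 = 0"
  shows "measure_pmf.expectation outcome_law (capped_max v \<kappa>) \<le> agent_utility v (index_strategy v \<kappa>)"
  unfolding agent_utility_amortized[OF assms(1) index_strategy_in]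
proof (rule expectation_mono)
  fix x assume x: "x \<in> set_pmf outcome_law"
  let ?\<sigma> = "index_strategy v \<kappa>"
  let ?h = "play ?\<sigma> x (card A)" and ?f = "\<lambda>i. max 0 (v (x i) - \<kappa> i)"
  let ?T = "taken A ?\<sigma> x" and ?j = "final_outcome A ?\<sigma> x"
  have h: "?h \<in> histories A m" by (rule play_in_histories[OF index_strategy_in x])
  note halt = index_strategy_halt[OF h final_outcome_revealed(2)[OF index_strategy_in x]]
  have T: "?T \<subseteq> A" "finite ?T"
    using taken_subset[OF index_strategy_in x] finite_subset[OF _ finite_actions] by blast+
  have rev: "v (x i) \<le> v ?j" if "i \<in> ?T" for i
    unfolding halt(1) using that
    by (intro best_revealed_ge insertI2) (simp add: taken_def snd_play)
  have rev0: "0 \<le> v ?j" unfolding halt(1) using best_revealed_ge[of 1 ?h v] assms(2) by simp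
  have unt: "\<kappa> i \<le> v ?j" if "i \<in> A - ?T" for i using halt(2) that by (simp add: taken_def)
  have bound: "capped_max v \<kappa> x \<le> y" if "0 \<le> y" "\<And>i. i \<in> A \<Longrightarrow> min (v (x i)) (\<kappa> i) \<le> y" for y
    unfolding capped_max_def using that finite_actions by (intro Max.boundedI) auto
  show "capped_max v \<kappa> x \<le> v ?j - sum ?f ?T"
    using index_strategy_invariant[where v=v and k="card A" and \<kappa>=\<kappa>, OF x assms(2), folded taken_def]
  proof
    assume a: "\<forall>i\<in>?T. v (x i) \<le> \<kappa> i"
    then have "sum ?f ?T = 0" by (intro sum.neutral) auto
    moreover have "capped_max v \<kappa> x \<le> v ?j"
    proof (rule bound)
      fix i assume "i \<in> A"
      then show "min (v (x i)) (\<kappa> i) \<le> v ?j"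
        using rev[of i] unt[of i] by (cases "i \<in> ?T") auto
    qed (rule rev0)
    ultimately show ?thesis by simp
  next
    assume "\<exists>i\<in>?T. \<kappa> i < v (x i) \<and> 0 \<le> \<kappa> i \<and>
       (\<forall>i'\<in>?T - {i}. v (x i') \<le> \<kappa> i' \<and> v (x i') \<le> \<kappa> i) \<and> (\<forall>i'\<in>A - ?T. \<kappa> i' \<le> \<kappa> i)"
    then obtain i where i: "i \<in> ?T" "\<kappa> i < v (x i)" "0 \<le> \<kappa> i"
      "\<And>i'. i' \<in> ?T - {i} \<Longrightarrow> v (x i') \<le> \<kappa> i' \<and> v (x i') \<le> \<kappa> i"
      "\<And>i'. i' \<in> A - ?T \<Longrightarrow> \<kappa> i' \<le> \<kappa> i" by blast
    have "sum ?f ?T = ?f i + sum ?f (?T - {i})" using T(2) i(1) by (rule sum.remove)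
    moreover have "sum ?f (?T - {i}) = 0" using i(4) by (intro sum.neutral) auto
    ultimately have "\<kappa> i \<le> v ?j - sum ?f ?T" using rev[OF i(1)] i(2) by auto
    moreover have "capped_max v \<kappa> x \<le> \<kappa> i"
    proof (rule bound)
      fix i' assume "i' \<in> A"
      then show "min (v (x i')) (\<kappa> i') \<le> \<kappa> i"
        using i(4,5)[of i'] by (cases "i' = i"; cases "i' \<in> ?T") (auto simp: min_le_iff_disj)
    qed (rule i(3))
    ultimately show ?thesis by simp
  qed
qed

subsection \<open>Linear contracts\<close>

definition tail_prob :: "nat \<Rightarrow> nat \<Rightarrow> real" where
  "tail_prob i j = (\<Sum>l\<in>{j<..m}. pmf (p i) l)"

definition tail_reward :: "nat \<Rightarrow> nat \<Rightarrow> real" where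
  "tail_reward i j = (\<Sum>l\<in>{j<..m}. pmf (p i) l * r l)"

text \<open>A positive tail makes the division in \<open>index_line\<close> meaningful. Threshold 0
  truncates nothing, so it always qualifies and the maximum below is over a nonempty set of at most
  \<open>m\<close> lines.\<close>

definition thresholds :: "nat \<Rightarrow> nat set" where
  "thresholds i = {j. j < m \<and> 0 < tail_prob i j}"

definition index_line :: "nat \<Rightarrow> nat \<Rightarrow> real \<Rightarrow> real" where
  "index_line i j \<alpha> = (\<alpha> * tail_reward i j - c i) / tail_prob i j"

definition linear_index :: "real \<Rightarrow> nat \<Rightarrow> real" where
  "linear_index \<alpha> i = Max ((\<lambda>j. index_line i j \<alpha>) ` thresholds i)"

text \<open>\<open>index_line i j \<alpha>\<close> solves \<open>E [(\<alpha> r (X\<^sub>i) - k) 1(X\<^sub>i > j)] = c\<^sub>i\<close> for \<open>k\<close>; the positive part in the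
  definition of the index is the maximum over \<open>j\<close> of these truncations, as \<open>r\<close> is monotone.\<close>

lemma finite_thresholds [simp]: "finite (thresholds i)"
  by (simp add: thresholds_def)

lemma expectation_outcome:
  fixes f :: "nat \<Rightarrow> real"
  shows "i \<in> A \<Longrightarrow> measure_pmf.expectation (p i) f = (\<Sum>l\<in>{1..m}. pmf (p i) l * f l)"
  using outcome_range[of i]
  by (subst integral_measure_pmf_real[where A="{1..m}"]) (auto simp: mult.commute)

lemma zero_in_thresholds: "i \<in> A \<Longrightarrow> 0 \<in> thresholds i"
  using outcome_range[of i] sum_pmf_eq_1[of "{1..m}" "p i"] outcomes_nonempty
  by (simp add: thresholds_def tail_prob_def atLeastSucAtMost_greaterThanAtMost[symmetric])

lemma index_line_le_iff:
  "j \<in> thresholds i \<Longrightarrow> index_line i j \<alpha> \<le> y \<longleftrightarrow> \<alpha> * tail_reward i j - y * tail_prob i j \<le> c i"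
  by (auto simp: thresholds_def index_line_def divide_le_eq algebra_simps)

lemma linear_index_le_iff:
  "i \<in> A \<Longrightarrow> linear_index \<alpha> i \<le> y \<longleftrightarrow> (\<forall>j\<in>thresholds i. index_line i j \<alpha> \<le> y)"
  unfolding linear_index_def using zero_in_thresholds[of i] by (subst Max_le_iff) auto

lemma linear_index_attained:
  assumes "i \<in> A" obtains j where "j \<in> thresholds i" "linear_index \<alpha> i = index_line i j \<alpha>"
proof -
  have "linear_index \<alpha> i \<in> (\<lambda>j. index_line i j \<alpha>) ` thresholds i"
    unfolding linear_index_def using zero_in_thresholds[OF assms] by (intro Max_in) auto
  with that show ?thesis by blast
qed

lemma index_law_linear:
  assumes "0 \<le> \<alpha>"
  shows "index_law (linear_contract r \<alpha>) (linear_index \<alpha>)"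
  unfolding index_law_def
proof
  fix i assume i: "i \<in> A"
  define k where "k = linear_index \<alpha> i"
  define e where "e l = pmf (p i) l * max 0 (\<alpha> * r l - k)" for l
  have tail: "\<alpha> * tail_reward i j - k * tail_prob i j = (\<Sum>l\<in>{j<..m}. pmf (p i) l * (\<alpha> * r l - k))" for j
    by (simp add: tail_reward_def tail_prob_def sum_distrib_left sum_subtractf[symmetric] algebra_simps)
  \<comment> \<open>The truncation that attains the index has value exactly \<open>c i\<close>, and
    no truncation exceeds the positive part.\<close>
  have "c i \<le> sum e {1..m}"
  proof -
    obtain j where j: "j \<in> thresholds i" "k = index_line i j \<alpha>"
      unfolding k_def by (rule linear_index_attained[OF i])
    then have "c i = \<alpha> * tail_reward i j - k * tail_prob i j"
      by (auto simp: thresholds_def index_line_def)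
    also have "\<dots> \<le> sum e {j<..m}"
      unfolding tail e_def by (intro sum_mono mult_left_mono) auto
    also have "\<dots> \<le> sum e {1..m}" by (intro sum_mono2) (auto simp: e_def)
    finally show ?thesis .
  qed
  moreover have "sum e {1..m} \<le> c i"
  proof -
    define L where "L = {l \<in> {1..m}. \<alpha> * r l \<le> k}"
    \<comment> \<open>The last outcome whose value does not exceed \<open>k\<close>, or 0 if there
      is none. By monotonicity of \<open>r\<close>, truncating at \<open>j\<close> gives exactly the
      positive part.\<close>
    define j where "j = (if L = {} then 0 else Max L)"
    have fL: "finite L" by (simp add: L_def)
    have jm: "j \<le> m" using Max_in[OF fL] by (auto simp: j_def L_def)
    have gt: "k < \<alpha> * r l" if "l \<in> {j<..m}" for l
    proof (rule ccontr)
      assume "\<not> k < \<alpha> * r l"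
      with that have "l \<in> L" by (auto simp: L_def)
      then have "l \<le> j" using fL by (auto simp: j_def)
      with that show False by simp
    qed
    have le: "\<alpha> * r l \<le> k" if "l \<in> {1..j}" for l
    proof -
      have "L \<noteq> {}" using that by (auto simp: j_def split: if_splits)
      then have "j \<in> L" using Max_in[OF fL] by (simp add: j_def)
      have "r l \<le> r j" using that jm by (intro mono_onD[OF reward_mono]) auto
      then have "\<alpha> * r l \<le> \<alpha> * r j" using assms by (rule mult_left_mono)
      with \<open>j \<in> L\<close> show ?thesis by (simp add: L_def)
    qed
    have "sum e {1..m} = sum e {j<..m}"
      using le by (intro sum.mono_neutral_right) (auto simp: e_def)
    also have "\<dots> = (\<Sum>l\<in>{j<..m}. pmf (p i) l * (\<alpha> * r l - k))"
      unfolding e_def using gt by (intro sum.cong) (auto simp: max_def dest: less_imp_le)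
    also have "\<dots> \<le> c i"
    proof (cases "j \<in> thresholds i")
      case True
      then have "index_line i j \<alpha> \<le> k" using linear_index_le_iff[OF i, of \<alpha> k] k_def by blast
      then show ?thesis unfolding tail[symmetric] index_line_le_iff[OF True] .
    next
      case False
      \<comment> \<open>Outside \<open>thresholds\<close> the tail is a null set, so the sum
        vanishes and the bound is just nonnegativity of the cost.\<close>
      have "pmf (p i) l = 0" if "l \<in> {j<..m}" for l
      proof -
        have "0 \<le> tail_prob i j" by (simp add: tail_prob_def sum_nonneg)
        with False that have "tail_prob i j = 0" by (auto simp: thresholds_def)
        then show ?thesis using that by (simp add: tail_prob_def sum_nonneg_eq_0_iff)
      qed
      then have "(\<Sum>l\<in>{j<..m}. pmf (p i) l * (\<alpha> * r l - k)) = 0" by (intro sum.neutral) auto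
      then show ?thesis using cost_nonneg[OF i] by simp
    qed
    finally show ?thesis .
  qed
  ultimately show "measure_pmf.expectation (p i) (\<lambda>j. max 0 (linear_contract r \<alpha> j - linear_index \<alpha> i)) = c i"
    using i by (simp add: expectation_outcome linear_contract_def e_def k_def)
qed

text \<open>For \<open>\<alpha> \<ge> 0\<close> the next lemmas identify this with the maximum over
  all strategies. The closed formula is what exposes the dependence on
  \<open>\<alpha>\<close>.\<close>

definition max_agent_utility :: "real \<Rightarrow> real" where
  "max_agent_utility \<alpha> =
     measure_pmf.expectation outcome_law (capped_max (linear_contract r \<alpha>) (linear_index \<alpha>))"

lemma linear_contract_first: "linear_contract r \<alpha> 1 = 0"
  by (simp only: linear_contract_def reward_first mult_zero_right)

lemma agent_utility_linear_le:
  "\<lbrakk>0 \<le> \<alpha>; \<pi> \<in> strategies A m\<rbrakk> \<Longrightarrow> agent_utility (linear_contract r \<alpha>) \<pi> \<le> max_agent_utility \<alpha>"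
  unfolding max_agent_utility_def
  by (rule agent_utility_le_capped_max[OF index_law_linear linear_contract_first])

lemma max_agent_utility_attained:
  assumes "0 \<le> \<alpha>"
  obtains \<pi> where "\<pi> \<in> strategies A m" "agent_utility (linear_contract r \<alpha>) \<pi> = max_agent_utility \<alpha>"
proof -
  have "max_agent_utility \<alpha> \<le>
      agent_utility (linear_contract r \<alpha>) (index_strategy (linear_contract r \<alpha>) (linear_index \<alpha>))"
    unfolding max_agent_utility_def
    by (rule index_strategy_ge_capped_max[OF index_law_linear[OF assms] linear_contract_first])
  with that[OF index_strategy_in] agent_utility_linear_le[OF assms index_strategy_in] show ?thesis
    by (meson order_antisym)
qed

subsection \<open>Breakpoints\<close>

text \<open>These sets are intervals because \<open>linear_index\<close> is convex in \<open>\<alpha>\<close>. Comparing each line of \<open>i\<close>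
  with the whole envelope of \<open>i'\<close>, rather than with its lines, keeps their number at \<open>O(n\<^sup>2 m)\<close>.\<close>

definition line_interval :: "nat \<times> nat \<times> nat \<Rightarrow> real set" where
  "line_interval = (\<lambda>(i, i', j). {\<alpha> \<in> {0..1}.
     linear_index \<alpha> i \<le> index_line i j \<alpha> \<and> linear_index \<alpha> i' \<le> index_line i j \<alpha>})"

definition reward_interval :: "nat \<times> nat \<Rightarrow> real set" where
  "reward_interval = (\<lambda>(i, j). {\<alpha> \<in> {0..1}. linear_index \<alpha> i \<le> \<alpha> * r j})"

definition break_intervals :: "real set set" where
  "break_intervals = line_interval ` (A \<times> A \<times> {..<m}) \<union> reward_interval ` (A \<times> {1..m})"

lemma index_line_eq: "index_line i j \<alpha> = tail_reward i j / tail_prob i j * \<alpha> - c i / tail_prob i j"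
  by (simp add: index_line_def diff_divide_distrib)

lemma finite_break_intervals: "finite break_intervals"
  using finite_actions by (simp add: break_intervals_def)

lemma card_break_intervals: "card break_intervals \<le> 2 * card A ^ 2 * m"
proof -
  have "card break_intervals \<le> card (A \<times> A \<times> {..<m}) + card (A \<times> {1..m})"
    unfolding break_intervals_def
    using finite_actions by (intro card_Un_le[THEN order_trans] add_mono card_image_le) auto
  also have "\<dots> = card A ^ 2 * m + card A * m"
    by (simp add: card_cartesian_product power2_eq_square)
  also have "\<dots> \<le> card A ^ 2 * m + card A ^ 2 * m"
    by (intro add_left_mono mult_right_mono) (auto simp: power2_eq_square)
  finally show ?thesis by simp
qed

text \<open>An upper envelope of lines stays below an affine function iff each of its lines does, so
  every such set is given by finitely many linear inequalities in \<open>\<alpha>\<close>.\<close>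

lemma break_intervals_closed_interval:
  assumes "I \<in> break_intervals"
  shows "\<exists>l h. I = {l..h}"
proof -
  let ?s = "\<lambda>i j. tail_reward i j / tail_prob i j" and ?q = "\<lambda>i j. c i / tail_prob i j"
  from assms consider i i' j where "i \<in> A" "i' \<in> A" "I = line_interval (i, i', j)"
    | i j where "i \<in> A" "I = reward_interval (i, j)"
    by (auto simp: break_intervals_def)
  then show ?thesis
  proof cases
    case 1
    have "I = {\<alpha> \<in> {0..1}. \<forall>(i'', l) \<in> {i} \<times> thresholds i \<union> {i'} \<times> thresholds i'.
        index_line i'' l \<alpha> \<le> index_line i j \<alpha>}"
      using 1 by (auto simp: line_interval_def linear_index_le_iff)
    also have "\<dots> = {\<alpha> \<in> {0..1}. \<forall>a \<in> {i} \<times> thresholds i \<union> {i'} \<times> thresholds i'.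
        (?s (fst a) (snd a) - ?s i j) * \<alpha> \<le> ?q (fst a) (snd a) - ?q i j}"
      unfolding index_line_eq by (auto simp: algebra_simps split_beta)
    finally have eq: "I = \<dots>" .
    show ?thesis unfolding eq by (rule polyhedron_in_unit_interval)
  next
    case 2
    have eq: "I = {\<alpha> \<in> {0..1}. \<forall>l \<in> thresholds i. (?s i l - r j) * \<alpha> \<le> ?q i l}"
      using 2 by (auto simp: reward_interval_def linear_index_le_iff index_line_eq algebra_simps)
    show ?thesis unfolding eq by (rule polyhedron_in_unit_interval)
  qed
qed

lemma index_line_le: "\<lbrakk>i \<in> A; j \<in> thresholds i\<rbrakk> \<Longrightarrow> index_line i j \<alpha> \<le> linear_index \<alpha> i"
  using linear_index_le_iff[of i \<alpha> "linear_index \<alpha> i"] by simp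

text \<open>Inside a piece every index is a single line and all comparisons among indices and
  rewards \<open>\<alpha> * r j\<close> are constant. Hence for each realization
  \<open>capped_max\<close> is one affine function of \<open>\<alpha>\<close>. Only the midpoint
  identity is recorded, which is what the slope argument uses.\<close>

lemma max_agent_utility_midpoint:
  assumes ab: "0 \<le> a" "a < b" "b \<le> 1"
    and nobreak: "\<And>I y. \<lbrakk>I \<in> break_intervals; y \<in> I; a < y; y < b\<rbrakk> \<Longrightarrow> {a..b} \<subseteq> I"
  shows "max_agent_utility a + max_agent_utility b = 2 * max_agent_utility ((a + b) / 2)"
proof -
  define d where "d = (a + b) / 2"
  have d: "a < d" "d < b" "d \<in> {0..1}" using ab by (auto simp: d_def)
  define cmp :: "(real \<Rightarrow> real) \<Rightarrow> (real \<Rightarrow> real) \<Rightarrow> bool" where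
    "cmp f g \<longleftrightarrow> (\<forall>\<alpha>\<in>{a..b}. f \<alpha> \<le> g \<alpha>) \<or> (\<forall>\<alpha>\<in>{a..b}. g \<alpha> \<le> f \<alpha>)" for f g
  \<comment> \<open>The line is chosen to attain the index at the midpoint \<open>d\<close>. Then
    \<open>d\<close> is an interior point lying in \<open>line_interval (i, i', j)\<close>, which
    therefore contains the whole piece.\<close>
  have dominate: "\<exists>j\<in>thresholds i. \<forall>\<alpha>\<in>{a..b}.
      linear_index \<alpha> i = index_line i j \<alpha> \<and> linear_index \<alpha> i' \<le> linear_index \<alpha> i"
    if i: "i \<in> A" "i' \<in> A" "linear_index d i' \<le> linear_index d i" for i i'
  proof -
    obtain j where j: "j \<in> thresholds i" "linear_index d i = index_line i j d"
      by (rule linear_index_attained[OF i(1)])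
    have "d \<in> line_interval (i, i', j)" using d(3) j(2) i(3) by (simp add: line_interval_def)
    moreover have "line_interval (i, i', j) \<in> break_intervals"
      using i j(1) by (auto simp: break_intervals_def thresholds_def)
    ultimately have "{a..b} \<subseteq> line_interval (i, i', j)" using d(1,2) by (intro nobreak)
    then have "linear_index \<alpha> i \<le> index_line i j \<alpha> \<and> linear_index \<alpha> i' \<le> index_line i j \<alpha>"
      if "\<alpha> \<in> {a..b}" for \<alpha>
      using that by (auto simp: line_interval_def)
    then show ?thesis using index_line_le[OF i(1) j(1)]
      by (intro bexI[OF _ j(1)] ballI) (smt (verit, best))
  qed
  have line: "\<exists>j. \<forall>\<alpha>\<in>{a..b}. linear_index \<alpha> i = index_line i j \<alpha>" if "i \<in> A" for i
    using dominate[OF that that] by blast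
  have cmp_index: "cmp (\<lambda>\<alpha>. linear_index \<alpha> i) (\<lambda>\<alpha>. linear_index \<alpha> i')" if "i \<in> A" "i' \<in> A" for i i'
    using dominate[OF that] dominate[OF that(2,1)] unfolding cmp_def by (meson linear)
  have cmp_reward: "cmp (\<lambda>\<alpha>. \<alpha> * r j) (\<lambda>\<alpha>. linear_index \<alpha> i)" if i: "i \<in> A" and j: "j \<in> {1..m}" for i j
  proof -
    have I: "reward_interval (i, j) \<in> break_intervals" using i j by (auto simp: break_intervals_def)
    show ?thesis
    proof (cases "d \<in> reward_interval (i, j)")
      case True
      then have "{a..b} \<subseteq> reward_interval (i, j)" using nobreak[OF I] d(1,2) by blast
      then show ?thesis by (auto simp: cmp_def reward_interval_def)
    next
      case False
      \<comment> \<open>No interior point lies in the interval, since otherwise \<open>d\<close>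
        would. So the index exceeds the reward strictly inside, and weakly at the endpoints by
        continuity of the line that represents it.\<close>
      obtain l where l: "\<And>\<alpha>. \<alpha> \<in> {a..b} \<Longrightarrow> linear_index \<alpha> i = index_line i l \<alpha>"
        using line[OF i] by blast
      have "0 \<le> index_line i l y - y * r j" if y: "y \<in> {a<..<b}" for y
      proof -
        have "y \<notin> reward_interval (i, j)"
        proof
          assume "y \<in> reward_interval (i, j)"
          then have "{a..b} \<subseteq> reward_interval (i, j)" using nobreak[OF I] y by simp
          with False d(1,2) show False by (meson atLeastAtMost_iff less_imp_le subsetD)
        qed
        with y ab l[of y] show ?thesis by (auto simp: reward_interval_def)
      qed
      moreover have "continuous_on (closure {a<..<b}) (\<lambda>y. index_line i l y - y * r j)"
        unfolding index_line_eq by (intro continuous_intros)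
      ultimately have "0 \<le> index_line i l y - y * r j" if "y \<in> {a..b}" for y
        using continuous_ge_on_closure[of "{a<..<b}" "\<lambda>y. index_line i l y - y * r j" y 0] that ab
        by simp
      then show ?thesis using l unfolding cmp_def by fastforce
    qed
  qed
  define F where "F = (\<lambda>j \<alpha>. \<alpha> * r j) ` {1..m} \<union> (\<lambda>i \<alpha>. linear_index \<alpha> i) ` A"
  have cmp_F: "cmp f g" if "f \<in> F" "g \<in> F" for f g
  proof -
    have "cmp (\<lambda>\<alpha>. \<alpha> * r j) (\<lambda>\<alpha>. \<alpha> * r j')" for j j'
      unfolding cmp_def using ab by (meson atLeastAtMost_iff linear mult_left_mono order_trans)
    moreover have "cmp (\<lambda>\<alpha>. linear_index \<alpha> i) (\<lambda>\<alpha>. \<alpha> * r j)" if "i \<in> A" "j \<in> {1..m}" for i j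
      using cmp_reward[OF that] by (auto simp: cmp_def)
    ultimately show ?thesis using that cmp_index cmp_reward unfolding F_def by auto
  qed
  have mid_F: "f a + f b = 2 * f d" if f: "f \<in> F" for f
  proof -
    consider j where "f = (\<lambda>\<alpha>. \<alpha> * r j)" | i where "i \<in> A" "f = (\<lambda>\<alpha>. linear_index \<alpha> i)"
      using f by (auto simp: F_def)
    then show ?thesis
    proof cases
      case 1
      then show ?thesis by (simp add: d_def algebra_simps)
    next
      case 2
      then obtain l where "\<And>\<alpha>. \<alpha> \<in> {a..b} \<Longrightarrow> f \<alpha> = index_line i l \<alpha>"
        using line by blast
      then have "f a = index_line i l a" "f b = index_line i l b" "f d = index_line i l d"
        using d(1,2) by auto
      moreover have "2 * (s * d) = s * a + s * b" for s by (simp add: d_def algebra_simps)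
      note this[of "tail_reward i l / tail_prob i l"]
      ultimately show ?thesis unfolding index_line_eq by linarith
    qed
  qed
  let ?\<phi> = "\<lambda>\<alpha> x. capped_max (linear_contract r \<alpha>) (linear_index \<alpha>) x"
  have "?\<phi> a x + ?\<phi> b x = 2 * ?\<phi> d x" if x: "x \<in> set_pmf outcome_law" for x
  proof -
    have "\<exists>f\<in>F. \<forall>\<alpha>\<in>{a..b}. min (\<alpha> * r (x i)) (linear_index \<alpha> i) = f \<alpha>" if i: "i \<in> A" for i
    proof -
      have xi: "x i \<in> {1..m}" using realization_range[OF x i] .
      have "(\<lambda>\<alpha>. \<alpha> * r (x i)) \<in> F" "(\<lambda>\<alpha>. linear_index \<alpha> i) \<in> F" using xi i by (auto simp: F_def)
      then show ?thesis using cmp_reward[OF i xi] unfolding cmp_def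
        by (metis (no_types, lifting) min.absorb1 min.absorb2)
    qed
    then obtain G where G: "\<And>i. i \<in> A \<Longrightarrow> G i \<in> F"
      "\<And>i \<alpha>. \<lbrakk>i \<in> A; \<alpha> \<in> {a..b}\<rbrakk> \<Longrightarrow> min (\<alpha> * r (x i)) (linear_index \<alpha> i) = G i \<alpha>"
      by metis
    \<comment> \<open>The function \<open>\<alpha> * r 1\<close> is zero; written this way, the 0 in
      \<open>capped_max\<close> is a member of \<open>F\<close>.\<close>
    define H where "H = insert (\<lambda>\<alpha>. \<alpha> * r 1) (G ` A)"
    have H: "finite H" "H \<noteq> {}" "H \<subseteq> F"
      using finite_actions G(1) outcomes_nonempty by (auto simp: H_def F_def)
    obtain g where g: "g \<in> H" "\<And>\<alpha>. \<alpha> \<in> {a..b} \<Longrightarrow> Max ((\<lambda>f. f \<alpha>) ` H) = g \<alpha>"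
      using Max_of_chain[OF H(1,2), of "{a..b}"] cmp_F H(3) unfolding cmp_def by blast
    have "?\<phi> \<alpha> x = g \<alpha>" if \<alpha>: "\<alpha> \<in> {a..b}" for \<alpha>
    proof -
      have "(\<lambda>f. f \<alpha>) ` H = insert 0 ((\<lambda>i. min (\<alpha> * r (x i)) (linear_index \<alpha> i)) ` A)"
        unfolding H_def image_insert image_image reward_first mult_zero_right
        using G(2) \<alpha> by (intro arg_cong[where f="insert 0"] image_cong) auto
      then show ?thesis using g(2)[OF \<alpha>] by (simp add: capped_max_def linear_contract_def)
    qed
    moreover have "a \<in> {a..b}" "b \<in> {a..b}" "d \<in> {a..b}" using d by auto
    ultimately show ?thesis using mid_F[of g] g(1) H(3) by auto
  qed
  then have "measure_pmf.expectation outcome_law (\<lambda>x. ?\<phi> a x + ?\<phi> b x) =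
      measure_pmf.expectation outcome_law (\<lambda>x. 2 * ?\<phi> d x)"
    by (intro integral_cong_AE) (auto simp: AE_measure_pmf_iff)
  then show ?thesis by (simp add: max_agent_utility_def d_def)
qed

subsection \<open>Comparing principal and agent\<close>

definition expected_reward :: "strategy \<Rightarrow> real" where
  "expected_reward \<pi> = measure_pmf.expectation outcome_law (\<lambda>x. r (final_outcome A \<pi> x))"

definition expected_cost :: "strategy \<Rightarrow> real" where
  "expected_cost \<pi> = measure_pmf.expectation outcome_law (\<lambda>x. \<Sum>i\<in>taken A \<pi> x. c i)"

lemma agent_utility_linear:
  "agent_utility (linear_contract r \<alpha>) \<pi> = \<alpha> * expected_reward \<pi> - expected_cost \<pi>"
  by (simp add: agent_utility_def expected_reward_def expected_cost_def linear_contract_def)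

lemma principal_utility_linear:
  "principal_utility (linear_contract r \<alpha>) \<pi> = (1 - \<alpha>) * expected_reward \<pi>"
  by (simp add: principal_utility_def expected_reward_def linear_contract_def algebra_simps)

lemma utilities_sum: "principal_utility t \<pi> + agent_utility t \<pi> = expected_reward \<pi> - expected_cost \<pi>"
  by (simp add: principal_utility_def agent_utility_def expected_reward_def expected_cost_def)

lemma expected_reward_nonneg: "\<pi> \<in> strategies A m \<Longrightarrow> 0 \<le> expected_reward \<pi>"
  unfolding expected_reward_def
  by (intro integral_nonneg_AE) (auto simp: AE_measure_pmf_iff intro!: reward_nonneg final_outcome_range)

lemma expected_cost_nonneg: "\<pi> \<in> strategies A m \<Longrightarrow> 0 \<le> expected_cost \<pi>"
  unfolding expected_cost_def using taken_subset cost_nonneg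
  by (intro integral_nonneg_AE) (auto simp: AE_measure_pmf_iff intro!: sum_nonneg)

lemma best_response_strategy: "best_response t \<in> strategies A m"
  and best_response_optimal: "\<pi> \<in> strategies A m \<Longrightarrow> agent_utility t \<pi> \<le> agent_utility t (best_response t)"
  using best_response_favoured[of t] by (auto simp: favoured_optimal_def agent_optimal_def)

text \<open>Halting at once costs nothing and pays \<open>t 1\<close>.\<close>

lemma agent_utility_best_response_nonneg:
  assumes "t \<in> contracts m"
  shows "0 \<le> agent_utility t (best_response t)"
proof -
  define \<pi> where "\<pi> = (\<lambda>h\<in>histories A m. Halt 1)"
  have "\<pi> \<in> strategies A m" by (auto simp: \<pi>_def strategies_def decisions_def)
  moreover have empty: "play \<pi> x k = []" for x k
    by (induction k) (auto simp: \<pi>_def histories_def)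
  have "agent_utility t \<pi> = t 1"
    unfolding agent_utility_def final_outcome_def taken_def empty
    by (simp add: \<pi>_def histories_def)
  moreover have "0 \<le> t 1" using assms outcomes_nonempty by (simp add: contracts_def)
  ultimately show ?thesis using best_response_optimal[of \<pi> t] by simp
qed

lemma best_response_linear:
  assumes "0 \<le> \<alpha>"
  shows "agent_utility (linear_contract r \<alpha>) (best_response (linear_contract r \<alpha>)) = max_agent_utility \<alpha>"
  using max_agent_utility_attained[OF assms] best_response_optimal best_response_strategy
    agent_utility_linear_le[OF assms] by (metis order_antisym)

text \<open>The agent's share is nonnegative, so the principal gets at most the welfare. Payments
  cancel in the welfare, which is the agent's utility when he receives the full reward.\<close>

lemma principal_value_le_max_agent_utility:
  assumes "t \<in> contracts m"
  shows "principal_value t \<le> max_agent_utility 1"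
proof -
  let ?\<pi> = "best_response t"
  have "principal_value t \<le> principal_utility t ?\<pi> + agent_utility t ?\<pi>"
    using agent_utility_best_response_nonneg[OF assms] by (simp add: principal_value_def)
  also have "\<dots> = agent_utility (linear_contract r 1) ?\<pi>"
    by (simp add: utilities_sum agent_utility_linear)
  also have "\<dots> \<le> max_agent_utility 1"
    using agent_utility_linear_le best_response_strategy by simp
  finally show ?thesis .
qed

lemma max_agent_utility_0: "max_agent_utility 0 \<le> 0"
  using max_agent_utility_attained[of 0] expected_cost_nonneg agent_utility_linear
  by (metis diff_0 mult_zero_left neg_le_0_iff_le order_refl)

section \<open>The optimum over linear contracts and the final count\<close>

abbreviation linear_optimum :: real where
  "linear_optimum \<equiv> (SUP \<alpha>\<in>{0..1}. principal_value (linear_contract r \<alpha>))"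

lemma principal_value_le_linear_optimum:
  assumes "\<alpha> \<in> {0..1}"
  shows "principal_value (linear_contract r \<alpha>) \<le> linear_optimum"
proof (rule cSUP_upper[OF assms])
  show "bdd_above ((\<lambda>\<alpha>. principal_value (linear_contract r \<alpha>)) ` {0..1})"
    using principal_value_le linear_contract_in_contracts by (intro bdd_aboveI2[where M="r m"]) blast
qed

lemma linear_optimum_nonneg: "0 \<le> linear_optimum"
  using principal_value_le_linear_optimum[of 1] by (simp add: principal_value_def principal_utility_linear)

text \<open>The fixed strategy \<open>\<pi>\<close> yields a line in \<open>\<alpha>\<close> that
  supports \<open>max_agent_utility\<close> from below and touches it at \<open>d\<close>. The
  midpoint identity forces contact at \<open>a\<close> and \<open>b\<close> too, so the slope is the
  expected reward of \<open>\<pi>\<close>.\<close>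

lemma max_agent_utility_piece:
  assumes "0 \<le> a" "a < b" "b \<le> 1"
    and "\<And>I y. \<lbrakk>I \<in> break_intervals; y \<in> I; a < y; y < b\<rbrakk> \<Longrightarrow> {a..b} \<subseteq> I"
  shows "max_agent_utility b - max_agent_utility a \<le> 2 * linear_optimum"
proof -
  define d where "d = (a + b) / 2"
  \<comment> \<open>The last inequality amounts to \<open>b \<le> 1\<close>. At \<open>b\<close>
    itself the principal's share \<open>1 - b\<close> may vanish, while the midpoint keeps at least
    half the length of the piece.\<close>
  have d: "0 \<le> d" "d \<le> 1" "b - a \<le> 2 * (1 - d)" using assms(1-3) by (simp_all add: d_def field_simps)
  define \<pi> where "\<pi> = best_response (linear_contract r d)"
  have \<pi>: "\<pi> \<in> strategies A m" by (simp add: \<pi>_def best_response_strategy)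
  let ?R = "expected_reward \<pi>" and ?K = "expected_cost \<pi>"
  have "d * ?R - ?K = max_agent_utility d"
    using best_response_linear[OF d(1)] by (simp add: \<pi>_def agent_utility_linear)
  moreover have "a * ?R - ?K \<le> max_agent_utility a" "b * ?R - ?K \<le> max_agent_utility b"
    using agent_utility_linear_le[OF _ \<pi>] assms(1,2) by (simp_all add: agent_utility_linear)
  moreover have "max_agent_utility a + max_agent_utility b = 2 * max_agent_utility d"
    unfolding d_def by (rule max_agent_utility_midpoint[OF assms])
  moreover have "2 * (d * ?R) = a * ?R + b * ?R" by (simp add: d_def algebra_simps)
  ultimately have "max_agent_utility b - max_agent_utility a = (b - a) * ?R"
    unfolding left_diff_distrib by linarith
  also have "\<dots> \<le> 2 * (1 - d) * ?R"
    using d(3) expected_reward_nonneg[OF \<pi>] by (rule mult_right_mono)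
  also have "\<dots> = 2 * principal_value (linear_contract r d)"
    by (simp add: principal_value_def principal_utility_linear \<pi>_def)
  also have "\<dots> \<le> 2 * linear_optimum" using principal_value_le_linear_optimum d by simp
  finally show ?thesis .
qed

lemma max_agent_utility_le_linear_optimum:
  "max_agent_utility 1 \<le> 10 * real (card A) ^ 2 * real m * linear_optimum"
proof (cases "A = {}")
  case True
  then have "max_agent_utility 1 = 0"
    unfolding max_agent_utility_def capped_max_def by simp
  with True show ?thesis by simp
next
  case False
  define N where "N = (card A)\<^sup>2 * m"
  have "max_agent_utility 1 \<le> max_agent_utility 1 - max_agent_utility 0"
    using max_agent_utility_0 by simp
  also have "\<dots> \<le> (2 * real (card break_intervals) + 1) * (2 * linear_optimum)"
    using finite_break_intervals break_intervals_closed_interval linear_optimum_nonneg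
      max_agent_utility_piece
    by (intro increment_le_card_pieces) auto
  \<comment> \<open>At most \<open>2 * N\<close> intervals give at most \<open>4 * N + 1\<close>
    pieces, and \<open>N \<ge> 1\<close> absorbs the 1. With the factor 2 per piece this yields the
    constant 10.\<close>
  also have "\<dots> \<le> (5 * real N) * (2 * linear_optimum)"
  proof (rule mult_right_mono)
    have "0 < N" using False finite_actions outcomes_nonempty by (simp add: N_def card_gt_0_iff)
    moreover have "card break_intervals \<le> 2 * N" using card_break_intervals by (simp add: N_def mult.assoc)
    ultimately show "2 * real (card break_intervals) + 1 \<le> 5 * real N" by linarith
  qed (use linear_optimum_nonneg in simp)
  finally show ?thesis by (simp add: N_def mult_ac)
qed

lemma general_contracts_le_linear:
  "(SUP t\<in>contracts m. principal_value t) \<le> 10 * real (card A) ^ 2 * real m * linear_optimum"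
proof (rule cSUP_least)
  show "contracts m \<noteq> {}" using linear_contract_in_contracts[of 0] by auto
  show "principal_value t \<le> 10 * real (card A) ^ 2 * real m * linear_optimum" if "t \<in> contracts m" for t
    using principal_value_le_max_agent_utility[OF that] max_agent_utility_le_linear_optimum
    by (rule order_trans)
qed

end

theorem mainTheorem6:
  "\<exists>C::real. C > 0 \<and>
     (\<forall>(A :: nat set) (n :: nat) (c :: nat \<Rightarrow> real) (m :: nat) (r :: nat \<Rightarrow> real)
        (p :: nat \<Rightarrow> nat pmf) (tie :: (strategy \<times> strategy) set).
        sequential_contract A c m r p tie \<longrightarrow> card A = n \<longrightarrow>
        (SUP t\<in>contracts m. sequential_contract.principal_value A c m r p tie t)
          \<le> C * real n ^ 2 * real m *
             (SUP \<alpha>\<in>{0..1}. sequential_contract.principal_value A c m r p tie (linear_contract r \<alpha>)))"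
  using sequential_contract.general_contracts_le_linear by (intro exI[of _ 10]) auto

end
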